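(* For all $n \in \mathbb{N}$ there exists a permutation $\pi_n$ of the set $\mathbb{N}_n = \{1,2,\dots,n\}$ such that $k+\pi_n(k)$ is prime for each integer $k$ with $1\le k\le n$.
   Context: $\mathbb{N}$ denotes the set of positive integers. For $n \in \mathbb{N}$, $\mathbb{N}_n$ denotes the finite set of integers $\{1,2,\dots,n\}$. A permutation of $\mathbb{N}_n$ is an ordering of its elements in which each number appears exactly once, i.e. a bijection $\mathbb{N}_n \to \mathbb{N}_n$; $\pi(k)$ denotes the image of $k$ under $\pi$. *)

theory Defs
  imports
    "HOL-Computational_Algebra.Primes"
    "HOL-Combinatorics.Permutations"
begin

end

theory Submission
  imports Defs Complex_Main "HOL-Library.Discrete_Functions"
begin

text \<open>
  Everything rests on Bertrand's postulate: for \<open>n \<ge> 1\<close> there is a prime \<open>p\<close> with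
  \<open>n < p \<le> 2 * n\<close>.  The reflection \<open>k \<mapsto> p - k\<close> maps the block \<open>{p - n..n}\<close> onto itself, and
  there \<open>k + (p - k) = p\<close> is prime.  What remains is the initial segment \<open>{1..p - n - 1}\<close>, which is
  strictly shorter than \<open>{1..n}\<close>, so strong induction completes the permutation.

  Bertrand's postulate is proved by Erdos's method, which compares two estimates of the central
  binomial coefficient \<open>B = 2 * n choose n\<close>.  It is at least \<open>4 ^ n / (2 * n)\<close>, because it
  is the largest entry of a row of Pascal's triangle with sum \<open>4 ^ n\<close>,
  where the two outer ones can be merged so that \<open>2 * n\<close> summands remain.  On the other hand Legendre's formula shows that the multiplicity of a prime in \<open>B\<close>
  counts the carries when \<open>n\<close> is added to itself in base \<open>p\<close>.  Hence every prime power in the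
  factorization of \<open>B\<close> is at most \<open>2 * n\<close>, primes above \<open>sqrt (2 * n)\<close> occur at most once, and
  primes in \<open>]2 * n / 3, n]\<close> do not occur at all once \<open>n \<ge> 5\<close>.  If there were no primes in \<open>]n, 2 * n]\<close> either,
  then \<open>B\<close> would be at most \<open>(2 * n) ^ (s - 1)\<close>, where \<open>s\<close> is the integer part of
  \<open>sqrt (2 * n)\<close>, times the product of all primes up to \<open>2 * n / 3\<close>, and that product is at most
  \<open>4 ^ (2 * n / 3)\<close>.  This contradicts the lower bound as soon as \<open>s \<ge> 30\<close>; an explicit chain of
  primes, each less than twice its predecessor, settles the smaller cases.
\<close>

section \<open>The product of the primes up to a bound\<close>

lemma prod_primes_dvd:
  fixes m :: nat
  assumes "finite P" and "\<And>p. p \<in> P \<Longrightarrow> prime p" and "\<And>p. p \<in> P \<Longrightarrow> p dvd m"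
  shows "\<Prod>P dvd m"
  using assms
proof (induction P rule: finite_induct)
  case (insert q P)
  have "coprime q (\<Prod>P)"
    using insert by (intro prod_coprime_right) (auto intro!: primes_coprime)
  with insert show ?case
    by (auto intro!: divides_mult)
qed simp

lemma binomial_odd_le: "(2 * m + 1) choose m \<le> 4 ^ m"
proof -
  have "(2 * m + 1) choose m \<le> (\<Sum>k\<le>m. (2 * m + 1) choose k)"
    by (rule member_le_sum) auto
  also have "\<dots> = 4 ^ m"
    by (simp only: binomial_r_part_sum power_mult) simp
  finally show ?thesis .
qed

lemma prime_dvd_binomial:
  fixes p :: nat
  assumes "prime p" "k < p" "n - k < p" "p \<le> n" "k \<le> n"
  shows "p dvd (n choose k)"
proof -
  have "p dvd fact k * fact (n - k) * (n choose k)"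
    using assms by (simp add: binomial_fact_lemma prime_dvd_fact_iff)
  with assms show ?thesis
    by (simp add: prime_dvd_mult_iff prime_dvd_fact_iff)
qed

text \<open>
  An even number above 2 is not prime, so only odd \<open>n = 2 * m + 1\<close> matter.  The primes in
  \<open>]m + 1, 2 * m + 1]\<close> all divide the binomial coefficient \<open>2 * m + 1 choose m\<close>, which contributes
  a factor of at most \<open>4 ^ m\<close>; the primes up to \<open>m + 1\<close> contribute at most \<open>4 ^ (m + 1)\<close> by
  induction.
\<close>

lemma primorial_le: "\<Prod>{p::nat. prime p \<and> p \<le> n} \<le> 4 ^ n"
proof (induction n rule: less_induct)
  case (less n)
  consider "n < 2" | "n = 2" | "n > 2" "even n" | m where "n = 2 * m + 1" "m \<ge> 1"
  proof (cases "even n")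
    case True
    then show ?thesis using that by linarith
  next
    case False
    then obtain m where "n = 2 * m + 1" by (rule oddE)
    then show ?thesis using that by (cases "m = 0") auto
  qed
  then show ?case
  proof cases
    case 1
    then have "{p::nat. prime p \<and> p \<le> n} = {}"
      by (auto dest: prime_ge_2_nat)
    then show ?thesis by (simp only: prod.empty) simp
  next
    case 2
    then have "{p::nat. prime p \<and> p \<le> n} = {2}"
      by (auto intro: antisym dest: prime_ge_2_nat)
    with 2 show ?thesis by simp
  next
    case 3
    have "\<not> prime n"
      using 3 primes_dvd_imp_eq two_is_prime_nat by blast
    then have "p \<le> n \<longleftrightarrow> p \<le> n - 1" if "prime p" for p
      using that 3 by (cases "p = n") auto
    then have "{p::nat. prime p \<and> p \<le> n} = {p. prime p \<and> p \<le> n - 1}"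
      by blast
    then have "\<Prod>{p::nat. prime p \<and> p \<le> n} \<le> 4 ^ (n - 1)"
      using less.IH[of "n - 1"] 3 by simp
    also have "\<dots> \<le> 4 ^ n"
      by (rule power_increasing) auto
    finally show ?thesis .
  next
    case 4
    let ?L = "{p::nat. prime p \<and> p \<le> m + 1}"
    let ?U = "{p::nat. prime p \<and> m + 1 < p \<and> p \<le> n}"
    have "{p::nat. prime p \<and> p \<le> n} = ?L \<union> ?U"
      using 4 by auto
    then have "\<Prod>{p::nat. prime p \<and> p \<le> n} = \<Prod>?L * \<Prod>?U"
      by (simp only:) (rule prod.union_disjoint, auto)
    moreover have "\<Prod>?L \<le> 4 ^ (m + 1)"
      using 4 by (intro less.IH) auto
    moreover have "\<Prod>?U \<le> 4 ^ m"
    proof -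
      have "\<Prod>?U dvd ((2 * m + 1) choose m)"
        using 4 by (intro prod_primes_dvd) (auto intro!: prime_dvd_binomial)
      then have "\<Prod>?U \<le> (2 * m + 1) choose m"
        by (rule dvd_imp_le) simp
      with binomial_odd_le show ?thesis
        using order_trans by blast
    qed
    ultimately have "\<Prod>{p::nat. prime p \<and> p \<le> n} \<le> 4 ^ (m + 1) * 4 ^ m"
      by (simp only: mult_le_mono)
    also have "\<dots> = 4 ^ n"
      using 4 by (simp flip: power_add)
    finally show ?thesis .
  qed
qed

section \<open>Prime powers in the central binomial coefficient\<close>

lemma multiplicity_eq_card:
  fixes p m :: nat
  assumes "prime p" "0 < m" "m \<le> N"
  shows "multiplicity p m = card {i \<in> {1..N}. p ^ i dvd m}"
proof -
  have "p ^ multiplicity p m \<le> m"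
    using assms by (intro dvd_imp_le multiplicity_dvd) auto
  moreover have "multiplicity p m < p ^ multiplicity p m"
    using assms prime_gt_1_nat by (intro power_gt_expt) auto
  ultimately have "multiplicity p m \<le> N"
    using assms by linarith
  have "\<not> is_unit p"
    using \<open>prime p\<close> not_prime_unit by blast
  then have "p ^ i dvd m \<longleftrightarrow> i \<le> multiplicity p m" for i
    using \<open>0 < m\<close> by (intro power_dvd_iff_le_multiplicity) simp_all
  with \<open>multiplicity p m \<le> N\<close> have "{i \<in> {1..N}. p ^ i dvd m} = {1..multiplicity p m}"
    by (simp only: set_eq_iff mem_Collect_eq atLeastAtMost_iff) (blast intro: order_trans)
  then show ?thesis
    by (simp only: card_atLeastAtMost diff_Suc_1)
qed

text \<open>
  Legendre's formula.  Any bound \<open>N \<ge> n\<close> may be used for the summation, since the terms with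
  \<open>p ^ i > n\<close> vanish; this makes it possible to add the formulas for different factorials.
\<close>

lemma multiplicity_fact:
  fixes p :: nat
  assumes "prime p" "n \<le> N"
  shows "multiplicity p (fact n) = (\<Sum>i\<in>{1..N}. n div p ^ i)"
  using assms(2)
proof (induction n)
  case (Suc n)
  have "multiplicity p (fact (Suc n)) = multiplicity p (Suc n) + multiplicity p (fact n)"
    using assms(1) unfolding fact_Suc of_nat_id
    by (intro prime_elem_multiplicity_mult_distrib) auto
  also have "\<dots> = (\<Sum>i\<in>{1..N}. (if p ^ i dvd Suc n then 1 else 0)) + (\<Sum>i\<in>{1..N}. n div p ^ i)"
    using Suc multiplicity_eq_card[OF assms(1), of "Suc n" N]
    by (simp add: sum.If_cases Int_def)
  also have "\<dots> = (\<Sum>i\<in>{1..N}. Suc n div p ^ i)"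
    unfolding sum.distrib[symmetric]
    by (intro sum.cong) (auto simp: div_Suc dvd_eq_mod_eq_0)
  finally show ?case .
qed simp

text \<open>
  The summand is 1 or 0 according to whether a carry into position \<open>i\<close> occurs when \<open>n\<close> is added
  to itself in base \<open>p\<close>: Kummer's theorem for the central binomial coefficient.
\<close>

lemma multiplicity_central_binomial:
  fixes p :: nat
  assumes "prime p"
  shows "multiplicity p ((2 * n) choose n) = (\<Sum>i\<in>{1..2 * n}. 2 * (n mod p ^ i) div p ^ i)"
proof -
  have pos: "0 < p ^ i" for i
    using assms prime_gt_0_nat by simp
  have carry: "2 * n div p ^ i = 2 * (n div p ^ i) + 2 * (n mod p ^ i) div p ^ i" for i
  proof -
    have "2 * n = 2 * (n mod p ^ i) + 2 * (n div p ^ i) * p ^ i"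
      using div_mult_mod_eq[of n "p ^ i"] by (simp only: mult.assoc)
    then have "2 * n div p ^ i = (2 * (n mod p ^ i) + 2 * (n div p ^ i) * p ^ i) div p ^ i"
      by (rule arg_cong)
    also have "\<dots> = 2 * (n div p ^ i) + 2 * (n mod p ^ i) div p ^ i"
      using pos[of i] by (intro div_mult_self1) linarith
    finally show ?thesis .
  qed
  have "n \<le> 2 * n"
    by simp
  have "fact (2 * n) = (fact n * fact n :: nat) * ((2 * n) choose n)"
    using binomial_fact_lemma[of n "2 * n"] by (simp add: mult_2)
  moreover have "multiplicity p ((fact n * fact n) * ((2 * n) choose n)) =
      multiplicity p (fact n) + multiplicity p (fact n) + multiplicity p ((2 * n) choose n)"
    using assms by (simp add: prime_elem_multiplicity_mult_distrib)
  ultimately have "multiplicity p (fact (2 * n)) =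
      multiplicity p (fact n) + multiplicity p (fact n) + multiplicity p ((2 * n) choose n)"
    by (rule ssubst)
  moreover have "multiplicity p (fact (2 * n)) =
      2 * multiplicity p (fact n) + (\<Sum>i\<in>{1..2 * n}. 2 * (n mod p ^ i) div p ^ i)"
    using multiplicity_fact[OF assms \<open>n \<le> 2 * n\<close>] multiplicity_fact[OF assms order_refl[of "2 * n"]]
    by (simp only: carry sum.distrib sum_distrib_left)
  ultimately show ?thesis by linarith
qed

text \<open>
  Every carry counted by the multiplicity happens at a position \<open>i\<close> with \<open>p ^ i \<le> 2 * n\<close>, and each
  position yields at most one carry, so the exponent cannot exceed the largest such position.
\<close>

lemma prime_power_central_binomial_le:
  fixes p :: nat
  assumes "prime p" "n \<ge> 1"
  shows "p ^ multiplicity p ((2 * n) choose n) \<le> 2 * n"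
proof (rule ccontr)
  define v where "v = multiplicity p ((2 * n) choose n)"
  assume "\<not> p ^ multiplicity p ((2 * n) choose n) \<le> 2 * n"
  then have large: "2 * n < p ^ v"
    unfolding v_def by (rule not_le[THEN iffD1])
  have pos: "0 < p ^ i" for i
    using assms prime_gt_0_nat by simp
  have "v > 0"
    using large assms by (cases v) auto
  have carry_le: "2 * (n mod p ^ i) div p ^ i \<le> (if i < v then 1 else 0)" for i
  proof (cases "i < v")
    case True
    have "2 * (n mod p ^ i) < 2 * p ^ i"
      using pos[of i] by simp
    then have "2 * (n mod p ^ i) div p ^ i < 2"
      using pos[of i] by (simp add: div_less_iff_less_mult)
    with True show ?thesis by simp
  next
    case False
    then have "p ^ v \<le> p ^ i"
      using assms prime_gt_0_nat by (intro power_increasing) (auto simp: Suc_le_eq)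
    with large have "2 * (n mod p ^ i) < p ^ i"
      using mod_less_eq_dividend[of n "p ^ i"] by linarith
    then show ?thesis by simp
  qed
  have "v \<le> (\<Sum>i\<in>{1..2 * n}. if i < v then 1 else 0)"
    unfolding v_def multiplicity_central_binomial[OF assms(1)]
    using carry_le[unfolded v_def multiplicity_central_binomial[OF assms(1)]] by (rule sum_mono)
  also have "\<dots> = card {i \<in> {1..2 * n}. i < v}"
    by (simp add: sum.If_cases Int_def)
  also have "\<dots> \<le> card {1..<v}"
    by (rule card_mono) auto
  finally show False
    using \<open>v > 0\<close> by simp
qed

text \<open>
  For \<open>2 * n / 3 < p \<le> n\<close> the last digit of \<open>n\<close> in base \<open>p\<close> is \<open>n - p < p / 2\<close>, so doubling it
  produces no carry, and \<open>n \<ge> 5\<close> guarantees \<open>2 * n < p\<^sup>2\<close>, so no higher carry is possible.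
\<close>

lemma prime_not_dvd_central_binomial:
  fixes p :: nat
  assumes "prime p" "n \<ge> 5" "2 * n < 3 * p" "p \<le> n"
  shows "\<not> p dvd ((2 * n) choose n)"
proof -
  have sq: "2 * n < p ^ 2"
  proof -
    have "p \<ge> 4"
      using assms by linarith
    then have "4 * p \<le> p * p"
      by simp
    with assms show ?thesis
      unfolding power2_eq_square by linarith
  qed
  have "2 * (n mod p ^ i) div p ^ i = 0" if "i \<ge> 1" for i
  proof (cases "i = 1")
    case True
    have "n mod p = n - p"
      using assms by (simp add: le_mod_geq)
    with True assms show ?thesis by simp
  next
    case False
    then have "p ^ 2 \<le> p ^ i"
      using assms that prime_gt_0_nat by (intro power_increasing) (auto simp: Suc_le_eq)
    with sq have "2 * (n mod p ^ i) < p ^ i"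
      using mod_less_eq_dividend[of n "p ^ i"] by linarith
    then show ?thesis by simp
  qed
  then have "multiplicity p ((2 * n) choose n) = 0"
    by (simp add: multiplicity_central_binomial[OF assms(1)])
  then show ?thesis
    using assms by (simp add: multiplicity_eq_zero_iff)
qed

section \<open>Bertrand's postulate\<close>

text \<open>
  Primes up to \<open>s\<close> contribute at most \<open>2 * n\<close> each, and there are fewer than \<open>s\<close> of them because 1
  is not prime.  Larger primes occur with exponent 1 and are at most \<open>2 * n / 3\<close>, so their
  product is bounded by a primorial.
\<close>

lemma central_binomial_le_of_no_prime:
  fixes n s :: nat
  assumes n: "n \<ge> 5" and s: "s \<ge> 1" "2 * n < (s + 1) ^ 2"
    and no_prime: "\<And>p. prime p \<Longrightarrow> n < p \<Longrightarrow> p \<le> 2 * n \<Longrightarrow> False"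
  shows "(2 * n) choose n \<le> (2 * n) ^ (s - 1) * 4 ^ (2 * n div 3)"
proof -
  define B where "B = (2 * n) choose n"
  define f where "f p = p ^ multiplicity p B" for p
  have "B > 0"
    by (simp add: B_def)
  let ?S = "{p \<in> prime_factors B. p \<le> s}"
  let ?L = "{p \<in> prime_factors B. s < p}"
  have f_le: "f p \<le> 2 * n" if "prime p" for p
    using prime_power_central_binomial_le[OF that, of n] n by (simp add: f_def B_def)
  have small: "3 * p \<le> 2 * n" if "p \<in> prime_factors B" for p
  proof (rule ccontr)
    assume "\<not> 3 * p \<le> 2 * n"
    have "prime p" "p dvd B"
      using that by auto
    have "1 \<le> multiplicity p B"
      using that \<open>B > 0\<close> \<open>prime p\<close> \<open>p dvd B\<close> by (simp add: Suc_le_eq prime_multiplicity_gt_zero_iff)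
    then have "p ^ 1 \<le> f p"
      unfolding f_def using \<open>prime p\<close> prime_gt_0_nat
      by (intro power_increasing) (auto simp: Suc_le_eq)
    then have "p \<le> 2 * n"
      using f_le[OF \<open>prime p\<close>] by simp
    with no_prime \<open>prime p\<close> have "p \<le> n"
      by (meson not_le)
    with \<open>\<not> 3 * p \<le> 2 * n\<close> \<open>prime p\<close> \<open>p dvd B\<close> n show False
      using prime_not_dvd_central_binomial[of p n] by (simp add: B_def)
  qed
  have "B = prod f (prime_factors B)"
    unfolding f_def using \<open>B > 0\<close> by (rule prime_factorization_nat)
  also have "prime_factors B = ?S \<union> ?L"
    by auto
  also have "prod f (?S \<union> ?L) = prod f ?S * prod f ?L"
    by (rule prod.union_disjoint) auto
  also have "prod f ?S \<le> (2 * n) ^ card ?S"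
  proof -
    have "prod f ?S \<le> (\<Prod>p\<in>?S. 2 * n)"
      using f_le by (intro prod_mono) auto
    then show ?thesis by simp
  qed
  also have "(2 * n) ^ card ?S \<le> (2 * n) ^ (s - 1)"
  proof -
    have "card ?S \<le> card {2..s}"
      by (rule card_mono) (auto intro!: prime_ge_2_nat)
    then show ?thesis
      using n by (intro power_increasing) auto
  qed
  also have "prod f ?L \<le> \<Prod>{p. prime p \<and> p \<le> 2 * n div 3}"
  proof -
    have "f p \<le> p" if "p \<in> ?L" for p
    proof -
      have "prime p" "s < p"
        using that by auto
      \<comment> \<open>An exponent of 2 or more would give \<open>p\<^sup>2 \<le> 2 * n < (s + 1)\<^sup>2 \<le> p\<^sup>2\<close>.\<close>
      have "multiplicity p B \<le> 1"
      proof (rule ccontr)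
        assume "\<not> multiplicity p B \<le> 1"
        then have "p ^ 2 \<le> f p"
          unfolding f_def using \<open>prime p\<close> prime_gt_0_nat
          by (intro power_increasing) (auto simp: Suc_le_eq)
        moreover have "(s + 1) ^ 2 \<le> p ^ 2"
          using \<open>s < p\<close> by (intro power_mono) auto
        ultimately show False
          using f_le[OF \<open>prime p\<close>] s by linarith
      qed
      then have "f p \<le> p ^ 1"
        unfolding f_def using \<open>prime p\<close> prime_gt_0_nat
        by (intro power_increasing) (auto simp: Suc_le_eq)
      then show ?thesis by simp
    qed
    then have "prod f ?L \<le> \<Prod>?L"
      by (intro prod_mono) auto
    also have "\<dots> \<le> \<Prod>{p. prime p \<and> p \<le> 2 * n div 3}"
    proof (rule dvd_imp_le)
      show "\<Prod>?L dvd \<Prod>{p. prime p \<and> p \<le> 2 * n div 3}"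
      proof (rule prod_dvd_prod_subset)
        have "p \<le> 2 * n div 3" if "p \<in> prime_factors B" for p
          using small[OF that] by linarith
        then show "?L \<subseteq> {p. prime p \<and> p \<le> 2 * n div 3}"
          by auto
      qed simp
      show "0 < \<Prod>{p::nat. prime p \<and> p \<le> 2 * n div 3}"
        by (intro prod_pos) (auto dest: prime_gt_0_nat)
    qed
    finally show ?thesis .
  qed
  also have "\<Prod>{p::nat. prime p \<and> p \<le> 2 * n div 3} \<le> 4 ^ (2 * n div 3)"
    by (rule primorial_le)
  finally show ?thesis
    by (simp add: B_def mult_le_mono)
qed

lemma six_power_less_exp:
  fixes s :: nat
  assumes "s \<ge> 30"
  shows "(s + 1) ^ 6 < 2 ^ s"
  using assms
proof (induction s rule: dec_induct)
  case (step s)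
  \<comment> \<open>One step multiplies the left-hand side by at most \<open>(32 / 31) ^ 6 < 2\<close>.\<close>
  have "31 ^ 6 * (Suc s + 1) ^ 6 = (31 * (Suc s + 1)) ^ 6"
    by (simp only: power_mult_distrib)
  also have "\<dots> \<le> (32 * (s + 1)) ^ 6"
    using step by (intro power_mono) auto
  also have "\<dots> = 32 ^ 6 * (s + 1) ^ 6"
    by (simp only: power_mult_distrib)
  also have "\<dots> \<le> 31 ^ 6 * (2 * (s + 1) ^ 6)"
    by simp
  finally have "(Suc s + 1) ^ 6 \<le> 2 * (s + 1) ^ 6"
    by simp
  with step show ?case by simp
qed simp

text \<open>
  Cubing \<open>4 ^ n \<le> (2 * n) ^ s * 4 ^ (2 * n / 3)\<close> gives \<open>4 ^ n \<le> (2 * n) ^ (3 * s)\<close>.  With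
  \<open>s\<^sup>2 \<le> 2 * n < (s + 1)\<^sup>2\<close> this becomes \<open>2 ^ s \<le> (s + 1) ^ 6\<close> after taking \<open>s\<close>-th roots,
  which is false for \<open>s \<ge> 30\<close>, that is, for \<open>2 * n \<ge> 900\<close>.
\<close>

lemma bertrand_large:
  fixes n :: nat
  assumes "n \<ge> 450"
  shows "\<exists>p. prime p \<and> n < p \<and> p \<le> 2 * n"
proof (rule ccontr)
  assume no_prime: "\<not> ?thesis"
  define s where "s = floor_sqrt (2 * n)"
  have s_le: "s ^ 2 \<le> 2 * n" and s_gt: "2 * n < (s + 1) ^ 2"
    unfolding s_def using Suc_floor_sqrt_power2_gt[of "2 * n"] by simp_all
  have "30 \<le> s"
    unfolding s_def using assms by (intro le_floor_sqrtI) simp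
  have "4 ^ n \<le> 2 * n * ((2 * n) choose n)"
  proof -
    have "real (4 ^ n) \<le> real (2 * n * ((2 * n) choose n))"
      using central_binomial_lower_bound[of n] assms by (simp add: field_simps)
    then show ?thesis
      by (simp only: of_nat_le_iff)
  qed
  also have "\<dots> \<le> 2 * n * ((2 * n) ^ (s - 1) * 4 ^ (2 * n div 3))"
    using assms no_prime s_gt \<open>30 \<le> s\<close>
    by (intro mult_le_mono2 central_binomial_le_of_no_prime) auto
  also have "\<dots> = (2 * n) ^ s * 4 ^ (2 * n div 3)"
    using \<open>30 \<le> s\<close> by (simp add: power_eq_if[of _ s])
  finally have "(4 ^ n) ^ 3 \<le> ((2 * n) ^ s * 4 ^ (2 * n div 3)) ^ 3"
    by (rule power_mono) simp
  also have "\<dots> = (2 * n) ^ (3 * s) * 4 ^ (3 * (2 * n div 3))"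
    by (simp only: power_mult_distrib power_mult[symmetric] mult.commute)
  also have "\<dots> \<le> (2 * n) ^ (3 * s) * 4 ^ (2 * n)"
    by (intro mult_le_mono2 power_increasing) auto
  finally have "4 ^ n * 4 ^ (2 * n) \<le> (2 * n) ^ (3 * s) * (4 ^ (2 * n) :: nat)"
    by (simp flip: power_add power_mult add: mult.commute)
  then have "4 ^ n \<le> (2 * n) ^ (3 * s)"
    by simp
  also have "\<dots> \<le> ((s + 1) ^ 2) ^ (3 * s)"
    using s_gt by (intro power_mono) auto
  also have "\<dots> = ((s + 1) ^ 6) ^ s"
    by (simp flip: power_mult)
  also have "\<dots> < (2 ^ s) ^ s"
    using six_power_less_exp[OF \<open>30 \<le> s\<close>] \<open>30 \<le> s\<close> by (intro power_strict_mono) auto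
  also have "\<dots> = 2 ^ (s ^ 2)"
    by (simp flip: power_mult add: power2_eq_square)
  also have "\<dots> \<le> 2 ^ (2 * n)"
    using s_le by (intro power_increasing) auto
  also have "\<dots> = 4 ^ n"
    by (simp add: power_mult)
  finally show False by simp
qed

theorem bertrand:
  fixes n :: nat
  assumes "n \<ge> 1"
  shows "\<exists>p. prime p \<and> n < p \<and> p \<le> 2 * n"
proof (cases "n \<ge> 450")
  case False
  let ?C = "{2, 3, 5, 7, 13, 23, 43, 83, 163, 317, 631} :: nat set"
  have "\<exists>p\<in>?C. n < p \<and> p \<le> 2 * n"
    using assms False by simp presburger
  moreover have "\<forall>p\<in>?C. prime p"
    by simp
  ultimately show ?thesis by blast
qed (rule bertrand_large)

section \<open>Permutations with prime sums\<close>

lemma bij_betw_reflection: "bij_betw (\<lambda>k. p - k) {p - n..n} {p - n..n}" if "n \<le> p" for n p :: nat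
  using that by (intro bij_betwI[where g = "\<lambda>k. p - k"]) auto

theorem proposition2p5:
  fixes n :: nat
  assumes "n \<ge> 1"
  shows "\<exists>\<pi>. \<pi> permutes {1..n} \<and> (\<forall>k\<in>{1..n}. prime (k + \<pi> k))"
proof (induction n rule: less_induct)
  \<comment> \<open>The induction includes \<open>n = 0\<close>, because the initial segment is empty when \<open>p = n + 1\<close>.\<close>
  case (less n)
  show ?case
  proof (cases "n = 0")
    case False
    then obtain p where p: "prime p" "n < p" "p \<le> 2 * n"
      using bertrand[of n] by auto
    let ?m = "p - n - 1"
    have "?m < n"
      using p by linarith
    then obtain \<sigma> where \<sigma>: "\<sigma> permutes {1..?m}" "\<forall>k\<in>{1..?m}. prime (k + \<sigma> k)"
      using less.IH by blast
    define \<pi> where "\<pi> k = (if k \<in> {p - n..n} then p - k else \<sigma> k)" for k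
    have split: "{1..n} = {1..?m} \<union> {p - n..n}"
      using p by auto
    have "\<pi> permutes {1..n}"
    proof (rule bij_imp_permutes)
      have "bij_betw \<pi> {1..?m} {1..?m} \<longleftrightarrow> bij_betw \<sigma> {1..?m} {1..?m}"
        by (rule bij_betw_cong) (auto simp: \<pi>_def)
      moreover have "bij_betw \<pi> {p - n..n} {p - n..n} \<longleftrightarrow>
          bij_betw (\<lambda>k. p - k) {p - n..n} {p - n..n}"
        by (rule bij_betw_cong) (auto simp: \<pi>_def)
      ultimately show "bij_betw \<pi> {1..n} {1..n}"
        unfolding split using permutes_imp_bij[OF \<sigma>(1)] bij_betw_reflection[of n p] p
        by (intro bij_betw_combine) auto
    next
      fix k assume "k \<notin> {1..n}"
      then show "\<pi> k = k"
        using permutes_not_in[OF \<sigma>(1), of k] unfolding split \<pi>_def by auto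
    qed
    moreover have "\<forall>k\<in>{1..n}. prime (k + \<pi> k)"
      using \<sigma>(2) p unfolding split \<pi>_def by auto
    ultimately show ?thesis by blast
  qed auto
qed

end
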